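(* Let $X$ be a real-valued random variable with distribution $F$ and suppose $\Pr(X<0)>0$. Let $A=[-X\mid X<0]$ and $B=[X\mid X\geq 0]$ be the associated nonnegative random variables. Suppose that the following two conditions hold: (i) for all odd $n\in\mathbb{N}$, $$\mathbb{E}\left[A^n e^{A}\right]\Pr(X<0)\leq \mathbb{E}\left[B^n e^{-B}\right]\Pr(X\geq 0);$$ (ii) $\mathbb{E}[\exp(2A)]<\infty$. Then the mixed Poisson distribution $Poi\bigwedge F$ exists, and the probability mass function of $Y\sim \left(Poi\bigwedge F\right)$ is given, for $n\in\mathbb{N}_0$, by $$f(n) = \frac{(-1)^n\,\mathbb{E}\left[A^n e^{A}\right]\Pr(X<0)+\mathbb{E}\left[B^n e^{-B}\right]\Pr(X\geq 0)}{n!}.$$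
   Context: Notation: $\mathbb{N}_0=\{0,1,2,\dots\}$. $A=[-X\mid X<0]$ denotes a random variable whose law is the conditional law of $-X$ given $X<0$, and $B=[X\mid X\ge 0]$ a random variable whose law is the conditional law of $X$ given $X\geq 0$ (if $\Pr(X\ge 0)=0$, the terms multiplied by $\Pr(X\geq 0)$ are read as $0$). A function $f$ on $\mathbb{N}_0$ is a valid probability mass function (PMF) if $f(n)\geq 0$ for all $n\in\mathbb{N}_0$ and $\sum_{n=0}^\infty f(n)=1$. For a real-valued random variable $X\sim F$ (not assumed nonnegative), the mixed Poisson distribution generated by $F$, denoted $Poi\bigwedge F$, is the distribution on $\mathbb{N}_0$ with PMF $f(n)=\mathbb{E}\left[X^n e^{-X}\right]/n!$, provided this $f$ is a valid PMF (in particular each expectation must be well defined and finite). The mixed Poisson distribution $Poi\bigwedge F$ is said to exist if this $f$ is a valid PMF. Writing $Y\sim(Poi\bigwedge F)$ means that $Y$ has this PMF. *)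

theory Defs
  imports "HOL-Probability.Probability"
begin

text \<open>
  The conditional law of a real random variable \<open>Z\<close> given an event \<open>P\<close> of positive probability.
  If \<open>P\<close> has probability zero, this is the null measure, so that every expectation
  under it is zero.
\<close>

definition cond_law :: "'a measure \<Rightarrow> ('a \<Rightarrow> bool) \<Rightarrow> ('a \<Rightarrow> real) \<Rightarrow> real measure" where
  "cond_law M P Z = distr (uniform_measure M {\<omega> \<in> space M. P \<omega>}) borel Z"

definition neg_law :: "'a measure \<Rightarrow> ('a \<Rightarrow> real) \<Rightarrow> real measure" where
  "neg_law M X = cond_law M (\<lambda>\<omega>. X \<omega> < 0) (\<lambda>\<omega>. - X \<omega>)"

definition nonneg_law :: "'a measure \<Rightarrow> ('a \<Rightarrow> real) \<Rightarrow> real measure" where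
  "nonneg_law M X = cond_law M (\<lambda>\<omega>. X \<omega> \<ge> 0) X"

definition valid_pmf :: "(nat \<Rightarrow> real) \<Rightarrow> bool" where
  "valid_pmf f \<longleftrightarrow> (\<forall>n. f n \<ge> 0) \<and> f sums 1"

definition mixed_poisson_fun :: "real measure \<Rightarrow> nat \<Rightarrow> real" where
  "mixed_poisson_fun F n = (\<integral>x. x ^ n * exp (- x) \<partial>F) / fact n"

text \<open>
  Integrability is demanded separately because the Bochner integral of a non-integrable
  function is zero by convention.
\<close>

definition mixed_poisson_exists :: "real measure \<Rightarrow> bool" where
  "mixed_poisson_exists F \<longleftrightarrow>
     (\<forall>n. integrable F (\<lambda>x. x ^ n * exp (- x))) \<and> valid_pmf (mixed_poisson_fun F)"

text \<open>Meaningful only if \<open>mixed_poisson_exists F\<close> holds.\<close>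

definition mixed_poisson :: "real measure \<Rightarrow> nat pmf" where
  "mixed_poisson F = embed_pmf (mixed_poisson_fun F)"

lemma pmf_mixed_poisson:
  assumes "mixed_poisson_exists F"
  shows "pmf (mixed_poisson F) n = mixed_poisson_fun F n"
proof -
  have nonneg: "\<And>k. mixed_poisson_fun F k \<ge> 0"
    and sums: "mixed_poisson_fun F sums 1"
    using assms by (auto simp: mixed_poisson_exists_def valid_pmf_def)
  have "(\<integral>\<^sup>+k. ennreal (mixed_poisson_fun F k) \<partial>count_space UNIV) = 1"
    using nonneg sums
    by (simp add: nn_integral_count_space_nat suminf_ennreal2 sums_iff)
  then show ?thesis
    unfolding mixed_poisson_def using nonneg by (intro pmf_embed_pmf) auto
qed

end

theory Submission
  imports Defs
begin

text \<open>
  The function $e^{-X}\sum_n |X|^n / n! = e^{|X|-X}$ equals $e^{2|X|}$ where $X < 0$ and $1$ where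
  $X \ge 0$, so it is integrable by (ii). It dominates $X^n e^{-X} / n!$ for every $n$ and all
  partial sums, so dominated convergence gives $\sum_n f(n) = E[e^X e^{-X}] = 1$.
  Only odd $n$ can produce negative values of $f$, and (i) excludes them.
\<close>

text \<open>Multiplying by the probability of the event cancels the normalisation of the conditional
  law, leaving an integral over \<open>M\<close> restricted to the event. Infinite values are
  allowed, so hypotheses (i) and (ii) can be carried over to \<open>M\<close> before any
  integrability is known.\<close>

lemma nn_integral_cond_law:
  assumes [measurable]: "Z \<in> borel_measurable M" "Measurable.pred M P" "g \<in> borel_measurable borel"
    and fin: "finite_measure M"
  shows "(\<integral>\<^sup>+x. ennreal (g x) \<partial>cond_law M P Z) * ennreal \<P>(\<omega> in M. P \<omega>)
           = (\<integral>\<^sup>+\<omega>. ennreal (indicator {\<omega>. P \<omega>} \<omega> * g (Z \<omega>)) \<partial>M)"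
proof -
  interpret finite_measure M by fact
  let ?A = "{\<omega> \<in> space M. P \<omega>}"
  have A [measurable]: "?A \<in> sets M" by measurable
  have eq: "(\<integral>\<^sup>+\<omega>. ennreal (indicator {\<omega>. P \<omega>} \<omega> * g (Z \<omega>)) \<partial>M)
      = (\<integral>\<^sup>+\<omega>. ennreal (g (Z \<omega>)) * indicator ?A \<omega> \<partial>M)"
    by (intro nn_integral_cong) (auto simp: indicator_def)
  have em: "emeasure M ?A = ennreal \<P>(\<omega> in M. P \<omega>)"
    by (rule emeasure_eq_measure)
  show ?thesis
  proof (cases "emeasure M ?A = 0")
    \<comment> \<open>On the left, a product with 0 is 0 in \<open>ennreal\<close> whatever the
      integral is; on the right, the integrand vanishes almost everywhere.\<close>
    case True
    then have "AE \<omega> in M. \<omega> \<notin> ?A"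
      by (intro AE_not_in null_setsI) auto
    then have "(\<integral>\<^sup>+\<omega>. ennreal (g (Z \<omega>)) * indicator ?A \<omega> \<partial>M) = (\<integral>\<^sup>+\<omega>. 0 \<partial>M)"
      by (intro nn_integral_cong_AE) (auto elim!: eventually_mono)
    with True eq em show ?thesis by simp
  next
    case False
    have "(\<integral>\<^sup>+x. ennreal (g x) \<partial>cond_law M P Z)
        = (\<integral>\<^sup>+\<omega>. ennreal (g (Z \<omega>)) * indicator ?A \<omega> \<partial>M) / emeasure M ?A"
      unfolding cond_law_def by (simp add: nn_integral_distr nn_integral_uniform_measure)
    \<comment> \<open>Cancelling in \<open>ennreal\<close> requires a value that is neither 0 nor
      infinite; finiteness of \<open>M\<close> excludes the latter.\<close>
    moreover have "emeasure M ?A / emeasure M ?A = 1"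
      using False emeasure_finite[of ?A]
      by (intro ennreal_divide_self) (simp_all only: infinity_ennreal_def less_top not_False_eq_True)
    ultimately show ?thesis
      by (simp only: eq em[symmetric] ennreal_divide_times mult_1_right)
  qed
qed

text \<open>The same cancellation for Bochner integrals, which turns the expectations in the claimed
  PMF into real integrals over \<open>M\<close> that can be added. It holds for every measurable
  \<open>g\<close>: without integrability both sides take the default value 0.\<close>

lemma integral_cond_law:
  fixes g :: "real \<Rightarrow> real"
  assumes [measurable]: "Z \<in> borel_measurable M" "Measurable.pred M P" "g \<in> borel_measurable borel"
    and fin: "finite_measure M"
  shows "(\<integral>x. g x \<partial>cond_law M P Z) * \<P>(\<omega> in M. P \<omega>)
           = (\<integral>\<omega>. indicator {\<omega>. P \<omega>} \<omega> * g (Z \<omega>) \<partial>M)"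
proof -
  interpret finite_measure M by fact
  let ?A = "{\<omega> \<in> space M. P \<omega>}"
  have A [measurable]: "?A \<in> sets M" by measurable
  have eq: "(\<integral>\<omega>. indicator {\<omega>. P \<omega>} \<omega> * g (Z \<omega>) \<partial>M)
      = (\<integral>\<omega>. indicator ?A \<omega> * g (Z \<omega>) \<partial>M)"
    by (intro Bochner_Integration.integral_cong) (auto simp: indicator_def)
  show ?thesis
  proof (cases "measure M ?A = 0")
    case True
    then have "AE \<omega> in M. \<omega> \<notin> ?A"
      by (intro AE_not_in null_setsI) (auto simp: emeasure_eq_measure)
    then have "(\<integral>\<omega>. indicator ?A \<omega> * g (Z \<omega>) \<partial>M) = (\<integral>\<omega>. 0 \<partial>M)"
      by (intro integral_cong_AE) (auto elim!: eventually_mono)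
    with True eq show ?thesis by simp
  next
    case False
    then have pos: "measure M ?A > 0"
      by (simp add: zero_less_measure_iff)
    \<comment> \<open>The density is rewritten as a real quotient inside \<open>ennreal\<close>, the
      form that \<open>integral_density\<close> expects.\<close>
    have "uniform_measure M ?A = density M (\<lambda>\<omega>. ennreal (indicator ?A \<omega> / measure M ?A))"
      unfolding uniform_measure_def using pos
      by (intro density_cong) (auto simp: emeasure_eq_measure indicator_def divide_ennreal simp flip: ennreal_1)
    then have "(\<integral>x. g x \<partial>cond_law M P Z)
        = (\<integral>\<omega>. indicator ?A \<omega> / measure M ?A * g (Z \<omega>) \<partial>M)"
      unfolding cond_law_def
      by (simp add: integral_distr integral_density del: times_divide_eq_left)
    also have "\<dots> = (\<integral>\<omega>. (indicator ?A \<omega> * g (Z \<omega>)) / measure M ?A \<partial>M)"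
      by simp
    also have "\<dots> = (\<integral>\<omega>. indicator ?A \<omega> * g (Z \<omega>) \<partial>M) / measure M ?A"
      by (rule integral_divide_zero)
    finally show ?thesis using pos eq by simp
  qed
qed

text \<open>All terms of the exponential series at |x| are nonnegative, so a finite partial sum
  stays below the total. A singleton \<open>I\<close> bounds a single moment, an initial segment
  bounds the partial sums.\<close>

lemma sum_abs_power_le_exp:
  fixes x :: real
  assumes "finite I"
  shows "(\<Sum>k\<in>I. \<bar>x\<bar> ^ k / fact k) \<le> exp \<bar>x\<bar>"
proof -
  have s: "(\<lambda>k. \<bar>x\<bar> ^ k / fact k) sums exp \<bar>x\<bar>"
    using exp_converges[of "\<bar>x\<bar>"] by (simp add: divide_inverse mult.commute)
  show ?thesis
    using sum_le_suminf[OF sums_summable[OF s] assms] s by (simp add: sums_iff)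
qed

theorem theorem3p1:
  fixes M :: "'a measure" and X :: "'a \<Rightarrow> real" and F :: "real measure"
  assumes "prob_space M"
    and "X \<in> borel_measurable M"
    and "F = distr M borel X"
    and "\<P>(\<omega> in M. X \<omega> < 0) > 0"
    and "\<And>n::nat. odd n \<Longrightarrow>
           (\<integral>\<^sup>+a. ennreal (a ^ n * exp a) \<partial>neg_law M X) * ennreal \<P>(\<omega> in M. X \<omega> < 0)
             \<le> (\<integral>\<^sup>+b. ennreal (b ^ n * exp (- b)) \<partial>nonneg_law M X) * ennreal \<P>(\<omega> in M. X \<omega> \<ge> 0)"
    and "(\<integral>\<^sup>+a. ennreal (exp (2 * a)) \<partial>neg_law M X) < \<infinity>"
  shows "mixed_poisson_exists F \<and>
         (\<forall>n::nat. pmf (mixed_poisson F) n =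
            ((- 1) ^ n * (\<integral>a. a ^ n * exp a \<partial>neg_law M X) * \<P>(\<omega> in M. X \<omega> < 0)
              + (\<integral>b. b ^ n * exp (- b) \<partial>nonneg_law M X) * \<P>(\<omega> in M. X \<omega> \<ge> 0)) / fact n)"
proof -
  interpret prob_space M by fact
  note [measurable] = \<open>X \<in> borel_measurable M\<close>
  let ?N = "{\<omega>. X \<omega> < 0}" and ?Q = "{\<omega>. X \<omega> \<ge> 0}"
  have fin: "finite_measure M" by unfold_locales
  have "(\<integral>\<^sup>+\<omega>. ennreal (indicator ?N \<omega> * exp (2 * - X \<omega>)) \<partial>M) < \<infinity>"
  proof -
    have "(\<integral>\<^sup>+\<omega>. ennreal (indicator ?N \<omega> * exp (2 * - X \<omega>)) \<partial>M)
        = (\<integral>\<^sup>+a. ennreal (exp (2 * a)) \<partial>neg_law M X) * ennreal \<P>(\<omega> in M. X \<omega> < 0)"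
      unfolding neg_law_def by (rule nn_integral_cond_law[symmetric]) (simp_all add: fin)
    also have "\<dots> < \<infinity>"
      using assms(6) by (simp add: ennreal_mult_less_top)
    finally show ?thesis .
  qed
  then have intN: "integrable M (\<lambda>\<omega>. indicator ?N \<omega> * exp (2 * - X \<omega>))"
    by (intro integrableI_nonneg) simp_all
  define W where "W \<omega> = exp (\<bar>X \<omega>\<bar> - X \<omega>)" for \<omega>
  have intW: "integrable M W"
  proof (rule Bochner_Integration.integrable_bound)
    \<comment> \<open>The first summand equals \<open>W\<close> where \<open>X\<close> is negative;
      the constant 1, integrable on a probability space, covers the rest.\<close>
    show "integrable M (\<lambda>\<omega>. indicator ?N \<omega> * exp (2 * - X \<omega>) + 1)"
      using intN by simp
  qed (simp add: W_def[abs_def], auto simp: W_def indicator_def)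
  have intX: "integrable M (\<lambda>\<omega>. X \<omega> ^ n * exp (- X \<omega>))" for n
  proof (rule Bochner_Integration.integrable_bound)
    show "integrable M (\<lambda>\<omega>. fact n * W \<omega>)"
      using intW by simp
    \<comment> \<open>One term of the exponential series at |X|, multiplied by
      \<open>fact n * exp (- X \<omega>)\<close>.\<close>
    have "\<bar>X \<omega>\<bar> ^ n * exp (- X \<omega>) \<le> fact n * W \<omega>" for \<omega>
      using sum_abs_power_le_exp[of "{n}" "X \<omega>"]
      by (simp add: W_def exp_diff exp_minus field_simps)
    then show "AE \<omega> in M. norm (X \<omega> ^ n * exp (- X \<omega>)) \<le> norm (fact n * W \<omega>)"
      by (simp add: abs_mult power_abs W_def)
  qed simp
  define f where "f n = (\<integral>\<omega>. X \<omega> ^ n * exp (- X \<omega>) \<partial>M) / fact n" for n :: nat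
  have f: "mixed_poisson_fun F = f"
    by (simp add: fun_eq_iff f_def mixed_poisson_fun_def assms(3) integral_distr)
  have "(\<lambda>m. \<Sum>n<m. f n) \<longlonglongrightarrow> 1"
  proof -
    have "(\<lambda>m. \<integral>\<omega>. (\<Sum>n<m. X \<omega> ^ n / fact n) * exp (- X \<omega>) \<partial>M) \<longlonglongrightarrow> (\<integral>\<omega>. 1 \<partial>M)"
    proof (rule integral_dominated_convergence[where w = W])
      have "(\<lambda>m. (\<Sum>n<m. x ^ n / fact n) * exp (- x)) \<longlonglongrightarrow> exp x * exp (- x)" for x :: real
        using exp_converges[of x]
        by (intro tendsto_mult) (simp_all add: sums_def divide_inverse mult.commute)
      then show "AE \<omega> in M. (\<lambda>m. (\<Sum>n<m. X \<omega> ^ n / fact n) * exp (- X \<omega>)) \<longlonglongrightarrow> 1"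
        by (simp flip: exp_add)
      \<comment> \<open>For negative \<open>x\<close> the series alternates, so the bound passes
        through absolute values; this is why |X| appears in \<open>W\<close>.\<close>
      have "norm ((\<Sum>n<m. x ^ n / fact n) * exp (- x)) \<le> exp (\<bar>x\<bar> - x)" for m and x :: real
      proof -
        have "\<bar>\<Sum>n<m. x ^ n / fact n\<bar> \<le> (\<Sum>n<m. \<bar>x\<bar> ^ n / fact n)"
          using sum_abs[of "\<lambda>n. x ^ n / fact n" "{..<m}"] by (simp add: power_abs)
        also have "\<dots> \<le> exp \<bar>x\<bar>"
          by (rule sum_abs_power_le_exp) simp
        finally have "\<bar>\<Sum>n<m. x ^ n / fact n\<bar> * exp (- x) \<le> exp \<bar>x\<bar> * exp (- x)"
          by (rule mult_right_mono) simp
        then show ?thesis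
          by (simp add: abs_mult flip: exp_add)
      qed
      then show "AE \<omega> in M. norm ((\<Sum>n<m. X \<omega> ^ n / fact n) * exp (- X \<omega>)) \<le> W \<omega>" for m
        by (simp add: W_def)
    qed (use intW in simp_all)
    moreover have "(\<integral>\<omega>. (\<Sum>n<m. X \<omega> ^ n / fact n) * exp (- X \<omega>) \<partial>M) = (\<Sum>n<m. f n)" for m
    proof -
      have "(\<integral>\<omega>. (\<Sum>n<m. X \<omega> ^ n / fact n) * exp (- X \<omega>) \<partial>M)
          = (\<integral>\<omega>. (\<Sum>n<m. (X \<omega> ^ n * exp (- X \<omega>)) / fact n) \<partial>M)"
        by (simp add: sum_distrib_right)
      also have "\<dots> = (\<Sum>n<m. \<integral>\<omega>. (X \<omega> ^ n * exp (- X \<omega>)) / fact n \<partial>M)"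
        using intX by (intro Bochner_Integration.integral_sum integrable_divide_zero) simp
      finally show ?thesis by (simp add: f_def)
    qed
    ultimately show ?thesis by (simp add: prob_space)
  qed
  then have sums: "f sums 1" by (simp add: sums_def)
  \<comment> \<open>\<open>a n\<close> and \<open>b n\<close> are the two probability-weighted
    expectations of the claim, written over \<open>M\<close>. Keeping the power of
    \<open>- X \<omega>\<close> makes \<open>a n\<close> nonnegative and leaves the sign to the
    factor \<open>(- 1) ^ n\<close>.\<close>
  define a where "a n = (\<integral>\<omega>. indicator ?N \<omega> * ((- X \<omega>) ^ n * exp (- X \<omega>)) \<partial>M)" for n
  define b where "b n = (\<integral>\<omega>. indicator ?Q \<omega> * (X \<omega> ^ n * exp (- X \<omega>)) \<partial>M)" for n
  have a: "(\<integral>x. x ^ n * exp x \<partial>neg_law M X) * \<P>(\<omega> in M. X \<omega> < 0) = a n" for n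
    unfolding neg_law_def a_def by (rule integral_cond_law) (simp_all add: fin)
  have b: "(\<integral>x. x ^ n * exp (- x) \<partial>nonneg_law M X) * \<P>(\<omega> in M. X \<omega> \<ge> 0) = b n" for n
    unfolding nonneg_law_def b_def by (rule integral_cond_law) (simp_all add: fin)
  have inta: "integrable M (\<lambda>\<omega>. indicator ?N \<omega> * ((- X \<omega>) ^ n * exp (- X \<omega>)))" for n
    by (rule Bochner_Integration.integrable_bound[OF intX[of n]])
       (auto simp: indicator_def abs_mult power_abs)
  have intb: "integrable M (\<lambda>\<omega>. indicator ?Q \<omega> * (X \<omega> ^ n * exp (- X \<omega>)))" for n
    by (rule Bochner_Integration.integrable_bound[OF intX[of n]]) (auto simp: indicator_def)
  have a0: "a n \<ge> 0" and b0: "b n \<ge> 0" for n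
    unfolding a_def b_def by (auto intro!: integral_nonneg_AE simp: indicator_def)
  have split: "f n = ((- 1) ^ n * a n + b n) / fact n" for n
  proof -
    have "(- 1) ^ n * a n + b n = (\<integral>\<omega>. (- 1) ^ n * (indicator ?N \<omega> * ((- X \<omega>) ^ n * exp (- X \<omega>)))
        + indicator ?Q \<omega> * (X \<omega> ^ n * exp (- X \<omega>)) \<partial>M)"
      unfolding a_def b_def using inta[of n] intb[of n] by simp
    \<comment> \<open>The two events partition the space, and on the negative one the product of the
      powers of -1 and \<open>- X \<omega>\<close> is \<open>X \<omega> ^ n\<close>.\<close>
    also have "\<dots> = (\<integral>\<omega>. X \<omega> ^ n * exp (- X \<omega>) \<partial>M)"
      by (intro Bochner_Integration.integral_cong)
         (auto simp: indicator_def simp flip: power_mult_distrib mult.assoc)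
    finally show ?thesis by (simp add: f_def)
  qed
  have "a n \<le> b n" if "odd n" for n
  proof -
    \<comment> \<open>Hypothesis (i) compares extended values. Integrability over \<open>M\<close>
      identifies both sides with \<open>ennreal (a n)\<close> and \<open>ennreal (b n)\<close>, and
      nonnegativity of \<open>b n\<close> brings the inequality back to the reals.\<close>
    have "ennreal (a n) = (\<integral>\<^sup>+x. ennreal (x ^ n * exp x) \<partial>neg_law M X) * ennreal \<P>(\<omega> in M. X \<omega> < 0)"
      unfolding a_def neg_law_def using inta
      by (subst nn_integral_cond_law)
         (auto simp: fin indicator_def intro!: nn_integral_eq_integral[symmetric])
    also have "\<dots> \<le> (\<integral>\<^sup>+x. ennreal (x ^ n * exp (- x)) \<partial>nonneg_law M X) * ennreal \<P>(\<omega> in M. X \<omega> \<ge> 0)"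
      using that by (rule assms(5))
    also have "\<dots> = ennreal (b n)"
      unfolding b_def nonneg_law_def using intb
      by (subst nn_integral_cond_law)
         (auto simp: fin indicator_def intro!: nn_integral_eq_integral)
    finally show ?thesis using b0 by (simp add: ennreal_le_iff)
  qed
  then have "f n \<ge> 0" for n
    using a0[of n] b0[of n] by (cases "even n") (auto simp: split)
  then have ex: "mixed_poisson_exists F"
    using sums intX f
    by (simp add: mixed_poisson_exists_def valid_pmf_def assms(3) integrable_distr_eq)
  \<comment> \<open>Existence comes first because \<open>embed_pmf\<close> is characterised only for
    genuine probability mass functions.\<close>
  show ?thesis
    using ex by (simp add: pmf_mixed_poisson f split a b mult.assoc)
qed

end
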